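(* Consider the functor $\mathbf{\Phi}$ from the category of diffeological spaces to the category of reflexive differential spaces given by $(X,\mathcal{D})\mapsto (X,\Phi\mathcal{D})$ on objects and $F\mapsto F$ on maps, and the functor $\mathbf{\Pi}$ from the category of differential spaces to the category of reflexive diffeological spaces given by $(X,\mathcal{F})\mapsto (X,\Pi\mathcal{F})$ on objects and $F\mapsto F$ on maps. The restriction of $\mathbf{\Phi}$ to the full subcategory of reflexive diffeological spaces is an isomorphism of categories onto the category of reflexive differential spaces. The restriction of $\mathbf{\Pi}$ to the full subcategory of reflexive differential spaces is an isomorphism of categories onto the category of reflexive diffeological spaces. These two isomorphisms are inverses of each other.
   Context: A parametrisation of a nonempty set $X$ is a function $p\colon U\to X$ where $U$ is an open subset of $\mathbb{R}^n$ for some $n$. A diffeology $\mathcal{D}$ on $X$ is a set of parametrisations of $X$ (called plots) such that: (1) (Covering) for every $x\in X$ and every nonnegative integer $n$, the constant function $\mathbb{R}^n\to\{x\}\subseteq X$ is in $\mathcal{D}$; (2) (Locality) if $p\colon U\to X$ is a parametrisation such that every $u\in U$ has an open neighbourhood $V$ in $U$ with $p|_V\in\mathcal{D}$, then $p\in\mathcal{D}$; (3) (Smooth compatibility) if $p\colon U\to X$ is in $\mathcal{D}$, $V\subseteq\mathbb{R}^n$ is open (any $n$), and $F\colon V\to U$ is infinitely differentiable, then $p\circ F\in\mathcal{D}$. A diffeological space is a pair $(X,\mathcal{D})$ of a nonempty set and a diffeology on it. A map $F\colon X\to Y$ of diffeological spaces is (diffeologically) smooth if $F\circ p$ is a plot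 of $Y$ for every plot $p$ of $X$. The initial topology of a family $\mathcal{F}$ of real-valued functions on a set is the weakest topology for which all functions in $\mathcal{F}$ are continuous. A differential structure on a nonempty set $X$ is a nonempty family $\mathcal{F}$ of functions $X\to\mathbb{R}$, along with its initial topology, such that: (1) (Smooth compatibility) for any positive integer $k$, $f_1,\dots,f_k\in\mathcal{F}$ and $F\in C^\infty(\mathbb{R}^k)$, the composition $F(f_1,\dots,f_k)$ is in $\mathcal{F}$; (2) (Locality) if $f\colon X\to\mathbb{R}$ is such that every $x\in X$ has an open neighbourhood $U$ (in the initial topology) and some $g\in\mathcal{F}$ with $f|_U=g|_U$, then $f\in\mathcal{F}$. A differential space is a pair $(X,\mathcal{F})$ of a nonempty set and a differential structure on it. A map $F\colon X\to Y$ of differential spaces $(X,\mathcal{F}_X)$, $(Y,\mathcal{F}_Y)$ is (functionally) smooth if $f\circ F\in\mathcal{F}_X$ for every $f\in\mathcal{F}_Y$. For a set $\mathcal{D}_0$ of parametrisations of $X$, $\Phi\mathcal{D}_0:=\{f\colon X\to\mathbb{R} \mid f\circ p\in C^\infty(U)\text{ for all }(p\colon U\to X)\in\mathcal{D}_0\}$. For a set $\mathcal{F}_0$ of real-valued functions on $X$, $\Pi\mathcal{F}_0:=\{\text{parametrisations }p\colon U\to X \mid f\circ p\in C^\infty(U)\text{ for all }f\in\mathcal{F}_0\}$. A diffeology $\mathcal{D}$ is reflexive if $\Pi\Phi\mathcal{D}=\mathcal{D}$; a differential structure $\mathcal{F}$ is reflexive if $\Phi\Pi\mathcal{F}=\mathcal{F}$.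 Diffeological spaces with diffeologically smooth maps form a category, as do differential spaces with functionally smooth maps; the reflexive ones form full subcategories. *)

theory Defs
  imports "HOL-Analysis.Analysis"
begin

section \<open>Smooth functions between open subsets of \<open>\<real>\<^sup>n\<close>\<close>

text \<open>The dimension is a quantified natural number throughout, so \<open>\<real>\<^sup>n\<close> is the library's
  \<^const>\<open>Euclidean_space\<close>: sequences vanishing from index \<open>n\<close> on.\<close>

abbreviation Rn :: "nat \<Rightarrow> (nat \<Rightarrow> real) set"
  where "Rn n \<equiv> topspace (Euclidean_space n)"

definition partial_deriv :: "nat \<Rightarrow> ((nat \<Rightarrow> real) \<Rightarrow> real) \<Rightarrow> (nat \<Rightarrow> real) \<Rightarrow> real"
  where "partial_deriv i f x = deriv (\<lambda>t. f (x(i := t))) (x i)"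

text \<open>\<open>Ck_on k n U f\<close>: all partial derivatives of \<open>f\<close> up to order \<open>k\<close> exist and are continuous on
  \<open>U\<close>. It is meant for \<open>U\<close> open in \<open>\<real>\<^sup>n\<close>, and then depends only on the values of \<open>f\<close> on \<open>U\<close>.\<close>

primrec Ck_on :: "nat \<Rightarrow> nat \<Rightarrow> (nat \<Rightarrow> real) set \<Rightarrow> ((nat \<Rightarrow> real) \<Rightarrow> real) \<Rightarrow> bool" where
  "Ck_on 0 n U f \<longleftrightarrow> continuous_map (subtopology (Euclidean_space n) U) euclideanreal f"
| "Ck_on (Suc k) n U f \<longleftrightarrow>
     continuous_map (subtopology (Euclidean_space n) U) euclideanreal f \<and>
     (\<forall>i<n. (\<forall>x\<in>U. (\<lambda>t. f (x(i := t))) field_differentiable (at (x i))) \<and>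
            Ck_on k n U (partial_deriv i f))"

definition smooth_fun :: "nat \<Rightarrow> (nat \<Rightarrow> real) set \<Rightarrow> ((nat \<Rightarrow> real) \<Rightarrow> real) \<Rightarrow> bool"
  where "smooth_fun n U f \<longleftrightarrow> (\<forall>k. Ck_on k n U f)"

definition smooth_map ::
  "nat \<Rightarrow> (nat \<Rightarrow> real) set \<Rightarrow> nat \<Rightarrow> (nat \<Rightarrow> real) set \<Rightarrow> ((nat \<Rightarrow> real) \<Rightarrow> nat \<Rightarrow> real) \<Rightarrow> bool"
  where "smooth_map m V n U F \<longleftrightarrow> F \<in> V \<rightarrow> U \<and> (\<forall>i<n. smooth_fun m V (\<lambda>x. F x i))"


section \<open>Diffeological spaces\<close>

text \<open>Functions with a given domain are encoded extensionally (\<open>\<rightarrow>\<^sub>E\<close>: value \<^const>\<open>undefined\<close>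
  outside the domain), so that equality of sets of functions is the intended one. A parametrisation
  is recorded together with the dimension and the domain.\<close>

type_synonym 'a param = "nat \<times> (nat \<Rightarrow> real) set \<times> ((nat \<Rightarrow> real) \<Rightarrow> 'a)"
type_synonym 'a dspace = "'a set \<times> 'a param set"

definition params :: "'a set \<Rightarrow> 'a param set"
  where "params X = {(n, U, p). openin (Euclidean_space n) U \<and> p \<in> U \<rightarrow>\<^sub>E X}"

definition is_diffeology :: "'a set \<Rightarrow> 'a param set \<Rightarrow> bool"
  where "is_diffeology X D \<longleftrightarrow>
    D \<subseteq> params X \<and>
    (\<forall>x\<in>X. \<forall>n. (n, Rn n, \<lambda>u\<in>Rn n. x) \<in> D) \<and>
    (\<forall>n U p. (n, U, p) \<in> params X \<and>
       (\<forall>u\<in>U. \<exists>V. openin (Euclidean_space n) V \<and> u \<in> V \<and> V \<subseteq> U \<and> (n, V, restrict p V) \<in> D)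
       \<longrightarrow> (n, U, p) \<in> D) \<and>
    (\<forall>n U p m V F. (n, U, p) \<in> D \<and> openin (Euclidean_space m) V \<and> smooth_map m V n U F
       \<longrightarrow> (m, V, compose V p F) \<in> D)"

definition diffeological_space :: "'a dspace \<Rightarrow> bool"
  where "diffeological_space S \<longleftrightarrow> fst S \<noteq> {} \<and> is_diffeology (fst S) (snd S)"

definition dsmooth :: "'a dspace \<Rightarrow> 'a dspace \<Rightarrow> ('a \<Rightarrow> 'a) set"
  where "dsmooth S T =
    {F \<in> fst S \<rightarrow>\<^sub>E fst T. \<forall>(n, U, p)\<in>snd S. (n, U, compose U F p) \<in> snd T}"


section \<open>Differential spaces\<close>

type_synonym 'a fspace = "'a set \<times> ('a \<Rightarrow> real) set"

definition real_funs :: "'a set \<Rightarrow> ('a \<Rightarrow> real) set"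
  where "real_funs X = X \<rightarrow>\<^sub>E UNIV"

definition initial_topology :: "'a set \<Rightarrow> ('a \<Rightarrow> real) set \<Rightarrow> 'a topology"
  where "initial_topology X \<F> =
    topology_generated_by (insert X {{x\<in>X. f x \<in> W} |f W. f \<in> \<F> \<and> open W})"

lemma topspace_initial_topology: "topspace (initial_topology X \<F>) = X"
  unfolding initial_topology_def by (subst topology_generated_by_topspace) auto

lemma continuous_map_initial_topology:
  assumes "f \<in> \<F>" shows "continuous_map (initial_topology X \<F>) euclideanreal f"
  unfolding continuous_map_def topspace_initial_topology
  using assms by (auto simp: initial_topology_def intro!: topology_generated_by_Basis)

lemma initial_topology_weakest:
  assumes X: "topspace T = X" and T: "\<And>f. f \<in> \<F> \<Longrightarrow> continuous_map T euclideanreal f"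
    and U: "openin (initial_topology X \<F>) U"
  shows "openin T U"
proof -
  have "openin T S" if "S \<in> insert X {{x\<in>X. f x \<in> W} |f W. f \<in> \<F> \<and> open W}" for S
    using that X T by (force simp: continuous_map_def)
  moreover have "generate_topology_on (insert X {{x\<in>X. f x \<in> W} |f W. f \<in> \<F> \<and> open W}) U"
    using U by (simp add: initial_topology_def openin_topology_generated_by_iff)
  ultimately show ?thesis
    by (rule_tac generate_topology_on_coarsest[of "openin T"]) auto
qed

definition is_differential_structure :: "'a set \<Rightarrow> ('a \<Rightarrow> real) set \<Rightarrow> bool"
  where "is_differential_structure X \<F> \<longleftrightarrow>
    \<F> \<noteq> {} \<and> \<F> \<subseteq> real_funs X \<and>
    (\<forall>k>0. \<forall>f G. (\<forall>i<k. f i \<in> \<F>) \<and> smooth_fun k (Rn k) G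
       \<longrightarrow> (\<lambda>x\<in>X. G (\<lambda>i. if i < k then f i x else 0)) \<in> \<F>) \<and>
    (\<forall>f\<in>real_funs X.
       (\<forall>x\<in>X. \<exists>U g. openin (initial_topology X \<F>) U \<and> x \<in> U \<and> g \<in> \<F> \<and> (\<forall>y\<in>U. f y = g y))
       \<longrightarrow> f \<in> \<F>)"

definition differential_space :: "'a fspace \<Rightarrow> bool"
  where "differential_space S \<longleftrightarrow> fst S \<noteq> {} \<and> is_differential_structure (fst S) (snd S)"

definition fsmooth :: "'a fspace \<Rightarrow> 'a fspace \<Rightarrow> ('a \<Rightarrow> 'a) set"
  where "fsmooth S T = {F \<in> fst S \<rightarrow>\<^sub>E fst T. \<forall>f\<in>snd T. compose (fst S) f F \<in> snd S}"


section \<open>The operators \<open>\<Phi>\<close> and \<open>\<Pi>\<close>, reflexivity\<close>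

definition Phi :: "'a set \<Rightarrow> 'a param set \<Rightarrow> ('a \<Rightarrow> real) set"
  where "Phi X D = {f \<in> real_funs X. \<forall>(n, U, p)\<in>D. smooth_fun n U (f \<circ> p)}"

text \<open>The operator \<open>\<Pi>\<close> is called \<open>Pai\<close> because \<open>Pi\<close> is the library's dependent function space.\<close>

definition Pai :: "'a set \<Rightarrow> ('a \<Rightarrow> real) set \<Rightarrow> 'a param set"
  where "Pai X \<F> = {(n, U, p). (n, U, p) \<in> params X \<and> (\<forall>f\<in>\<F>. smooth_fun n U (f \<circ> p))}"

definition reflexive_dspace :: "'a dspace \<Rightarrow> bool"
  where "reflexive_dspace S \<longleftrightarrow> Pai (fst S) (Phi (fst S) (snd S)) = snd S"

definition reflexive_fspace :: "'a fspace \<Rightarrow> bool"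
  where "reflexive_fspace S \<longleftrightarrow> Phi (fst S) (Pai (fst S) (snd S)) = snd S"


section \<open>Categories and functors\<close>

record ('o, 'm) category =
  Obj :: "'o set"
  Arr :: "'m set"
  Dom :: "'m \<Rightarrow> 'o"
  Cod :: "'m \<Rightarrow> 'o"
  Ident :: "'o \<Rightarrow> 'm"
  Comp :: "'m \<Rightarrow> 'm \<Rightarrow> 'm"  \<comment> \<open>\<open>Comp C g f\<close> is \<open>g\<close> after \<open>f\<close>\<close>

definition is_category :: "('o, 'm) category \<Rightarrow> bool"
  where "is_category C \<longleftrightarrow>
    (\<forall>f\<in>Arr C. Dom C f \<in> Obj C \<and> Cod C f \<in> Obj C) \<and>
    (\<forall>a\<in>Obj C. Ident C a \<in> Arr C \<and> Dom C (Ident C a) = a \<and> Cod C (Ident C a) = a) \<and>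
    (\<forall>f\<in>Arr C. \<forall>g\<in>Arr C. Cod C f = Dom C g \<longrightarrow>
       Comp C g f \<in> Arr C \<and> Dom C (Comp C g f) = Dom C f \<and> Cod C (Comp C g f) = Cod C g) \<and>
    (\<forall>f\<in>Arr C. Comp C f (Ident C (Dom C f)) = f \<and> Comp C (Ident C (Cod C f)) f = f) \<and>
    (\<forall>f\<in>Arr C. \<forall>g\<in>Arr C. \<forall>h\<in>Arr C. Cod C f = Dom C g \<and> Cod C g = Dom C h \<longrightarrow>
       Comp C h (Comp C g f) = Comp C (Comp C h g) f)"

definition full_subcategory :: "('o, 'm) category \<Rightarrow> ('o \<Rightarrow> bool) \<Rightarrow> ('o, 'm) category"
  where "full_subcategory C P =
    C\<lparr>Obj := {a \<in> Obj C. P a}, Arr := {f \<in> Arr C. P (Dom C f) \<and> P (Cod C f)}\<rparr>"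

text \<open>Functors are extensional on objects and arrows, so that equality of functors with a given
  source and target is equality of records.\<close>

record ('o, 'm, 'o2, 'm2) cfunctor =
  FObj :: "'o \<Rightarrow> 'o2"
  FArr :: "'m \<Rightarrow> 'm2"

definition is_functor ::
  "('o, 'm) category \<Rightarrow> ('o2, 'm2) category \<Rightarrow> ('o, 'm, 'o2, 'm2) cfunctor \<Rightarrow> bool"
  where "is_functor C D F \<longleftrightarrow>
    is_category C \<and> is_category D \<and>
    FObj F \<in> Obj C \<rightarrow>\<^sub>E Obj D \<and> FArr F \<in> Arr C \<rightarrow>\<^sub>E Arr D \<and>
    (\<forall>f\<in>Arr C. Dom D (FArr F f) = FObj F (Dom C f) \<and> Cod D (FArr F f) = FObj F (Cod C f)) \<and>
    (\<forall>a\<in>Obj C. FArr F (Ident C a) = Ident D (FObj F a)) \<and>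
    (\<forall>f\<in>Arr C. \<forall>g\<in>Arr C. Cod C f = Dom C g \<longrightarrow>
       FArr F (Comp C g f) = Comp D (FArr F g) (FArr F f))"

definition id_functor :: "('o, 'm) category \<Rightarrow> ('o, 'm, 'o, 'm) cfunctor"
  where "id_functor C = \<lparr>FObj = (\<lambda>a\<in>Obj C. a), FArr = (\<lambda>f\<in>Arr C. f)\<rparr>"

definition comp_functor ::
  "('o, 'm) category \<Rightarrow> ('o2, 'm2, 'o3, 'm3) cfunctor \<Rightarrow> ('o, 'm, 'o2, 'm2) cfunctor
    \<Rightarrow> ('o, 'm, 'o3, 'm3) cfunctor"
  where "comp_functor C G F =
    \<lparr>FObj = compose (Obj C) (FObj G) (FObj F), FArr = compose (Arr C) (FArr G) (FArr F)\<rparr>"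

definition restrict_functor ::
  "('o, 'm, 'o2, 'm2) cfunctor \<Rightarrow> ('o, 'm) category \<Rightarrow> ('o, 'm, 'o2, 'm2) cfunctor"
  where "restrict_functor F C =
    \<lparr>FObj = restrict (FObj F) (Obj C), FArr = restrict (FArr F) (Arr C)\<rparr>"

definition inverse_functors ::
  "('o, 'm) category \<Rightarrow> ('o2, 'm2) category \<Rightarrow> ('o, 'm, 'o2, 'm2) cfunctor
    \<Rightarrow> ('o2, 'm2, 'o, 'm) cfunctor \<Rightarrow> bool"
  where "inverse_functors C D F G \<longleftrightarrow>
    is_functor C D F \<and> is_functor D C G \<and>
    comp_functor C G F = id_functor C \<and> comp_functor D F G = id_functor D"

definition is_isomorphism ::
  "('o, 'm) category \<Rightarrow> ('o2, 'm2) category \<Rightarrow> ('o, 'm, 'o2, 'm2) cfunctor \<Rightarrow> bool"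
  where "is_isomorphism C D F \<longleftrightarrow> (\<exists>G. inverse_functors C D F G)"


section \<open>The categories of spaces and the functors between them\<close>

text \<open>An object is a carrier \<open>X \<subseteq> UNIV :: 'a set\<close> with a structure on it; an arrow carries its
  source and target. The type \<open>'a\<close> plays the role of the universe.\<close>

type_synonym ('a, 's) space_arr = "('a set \<times> 's) \<times> ('a \<Rightarrow> 'a) \<times> ('a set \<times> 's)"
type_synonym ('a, 's) space_cat = "('a set \<times> 's, ('a, 's) space_arr) category"

definition concrete_category ::
  "('a set \<times> 's \<Rightarrow> bool) \<Rightarrow> ('a set \<times> 's \<Rightarrow> 'a set \<times> 's \<Rightarrow> ('a \<Rightarrow> 'a) set) \<Rightarrow> ('a, 's) space_cat"
  where "concrete_category P H =
    \<lparr>Obj = {S. P S},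
     Arr = {(S, F, T). P S \<and> P T \<and> F \<in> H S T},
     Dom = (\<lambda>(S, F, T). S),
     Cod = (\<lambda>(S, F, T). T),
     Ident = (\<lambda>S. (S, \<lambda>x\<in>fst S. x, S)),
     Comp = (\<lambda>(S', G, T') (S, F, T). (S, compose (fst S) G F, T'))\<rparr>"

definition Diffeol :: "('a, 'a param set) space_cat"
  where "Diffeol = concrete_category diffeological_space dsmooth"

definition DiffSp :: "('a, ('a \<Rightarrow> real) set) space_cat"
  where "DiffSp = concrete_category differential_space fsmooth"

definition ReflDiffeol :: "('a, 'a param set) space_cat"
  where "ReflDiffeol = full_subcategory Diffeol reflexive_dspace"

definition ReflDiffSp :: "('a, ('a \<Rightarrow> real) set) space_cat"
  where "ReflDiffSp = full_subcategory DiffSp reflexive_fspace"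

definition Phi_functor ::
  "('a dspace, ('a, 'a param set) space_arr, 'a fspace, ('a, ('a \<Rightarrow> real) set) space_arr) cfunctor"
  where "Phi_functor =
    \<lparr>FObj = (\<lambda>(X, D)\<in>Obj Diffeol. (X, Phi X D)),
     FArr = (\<lambda>((X, D), F, (Y, E))\<in>Arr Diffeol. ((X, Phi X D), F, (Y, Phi Y E)))\<rparr>"

definition Pai_functor ::
  "('a fspace, ('a, ('a \<Rightarrow> real) set) space_arr, 'a dspace, ('a, 'a param set) space_arr) cfunctor"
  where "Pai_functor =
    \<lparr>FObj = (\<lambda>(X, \<F>)\<in>Obj DiffSp. (X, Pai X \<F>)),
     FArr = (\<lambda>((X, \<F>), F, (Y, \<G>))\<in>Arr DiffSp. ((X, Pai X \<F>), F, (Y, Pai Y \<G>)))\<rparr>"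

end

theory Submission
  imports Defs
begin

text \<open>
  The operators \<open>\<Phi>\<close> and \<open>\<Pi>\<close> form an antitone Galois connection between sets of parametrisations and
  sets of real functions: both \<open>D \<subseteq> \<Pi>F\<close> and \<open>F \<subseteq> \<Phi>D\<close> say that \<open>f \<circ> p\<close> is smooth for all \<open>f\<close> in \<open>F\<close> and
  all \<open>p\<close> in \<open>D\<close>. Hence \<open>\<Phi>\<Pi>\<Phi> = \<Phi>\<close> and \<open>\<Pi>\<Phi>\<Pi> = \<Pi>\<close> (\<open>Phi_Pai_Phi\<close>, \<open>Pai_Phi_Pai\<close>), so the values of the two
  operators are reflexive, and on reflexive structures the operators are inverse to each other by
  the definition of reflexivity. A map \<open>F\<close> that is smooth in one sense is smooth in the other for the
  associated structures, because \<open>f \<circ> F \<circ> p\<close> can be bracketed in two ways. As both functors leave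
  the underlying functions alone, nothing else has to be checked about arrows
  (\<open>is_functor_restructure\<close>, \<open>inverse_functors_restructure\<close>).

  The analytic content is that \<open>\<Phi>D\<close> is a differential structure and \<open>\<Pi>F\<close> is a diffeology
  (\<open>is_differential_structure_Phi\<close>, \<open>is_diffeology_Pai\<close>). This rests on two properties of smooth
  functions on open subsets of \<open>\<real>\<^sup>n\<close>: smoothness is local (\<open>smooth_fun_locally\<close>), and composites of
  smooth maps are smooth (\<open>smooth_fun_compose\<close>). The latter needs the chain rule in coordinates
  (\<open>has_real_derivative_along_curve\<close>), which the mean value theorem yields by moving one coordinate
  at a time. The axiom that functions locally in \<open>\<Phi>D\<close> belong to \<open>\<Phi>D\<close> refers to the initial topology,
  and holds because plots are continuous for it (\<open>continuous_map_plot\<close>).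
\<close>

section \<open>The chain rule in coordinates\<close>

text \<open>Boxes, and not balls, since a box contains every point that mixes coordinates of two of its
  points; the chain rule below moves from one point to another along coordinate directions.\<close>

definition coord_box :: "nat \<Rightarrow> (nat \<Rightarrow> real) \<Rightarrow> real \<Rightarrow> (nat \<Rightarrow> real) set"
  where "coord_box n x e = {y \<in> Rn n. \<forall>i<n. \<bar>y i - x i\<bar> < e}"

lemma openin_contains_coord_box:
  assumes U: "openin (Euclidean_space n) U" and x: "x \<in> U"
  obtains e where "e > 0" "coord_box n x e \<subseteq> U"
proof -
  obtain W where W: "openin (powertop_real UNIV) W" "U = W \<inter> {x. \<forall>i\<ge>n. x i = 0}"
    using U by (auto simp: Euclidean_space_def openin_subtopology)
  have "\<forall>x\<in>W. \<exists>B. finite {i. B i \<noteq> UNIV} \<and> (\<forall>i. open (B i)) \<and> x \<in> Pi UNIV B \<and> Pi UNIV B \<subseteq> W"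
    using W(1) by (simp add: openin_product_topology_alt PiE_UNIV_domain)
  moreover have "x \<in> W" using W(2) x by blast
  ultimately obtain B where B: "\<And>i. open (B i)" "x \<in> Pi UNIV B" "Pi UNIV B \<subseteq> W"
    by blast
  have "\<exists>d>0. ball (x i) d \<subseteq> B i" for i
    using openE[OF B(1)] B(2) by (metis PiE UNIV_I)
  then obtain d where d: "\<And>i. d i > 0" "\<And>i. ball (x i) (d i) \<subseteq> B i"
    by metis
  \<comment> \<open>Coordinates from \<open>n\<close> on do not move inside \<open>\<real>\<^sup>n\<close>, so finitely many radii matter.
    The element \<open>1\<close> keeps the minimum defined when \<open>n = 0\<close>.\<close>
  define e where "e = Min (insert 1 (d ` {..<n}))"
  have "e > 0" using d by (auto simp: e_def)
  moreover have "coord_box n x e \<subseteq> U"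
  proof
    fix y assume y: "y \<in> coord_box n x e"
    have "y i \<in> B i" for i
    proof (cases "i < n")
      case True
      then have "e \<le> d i" by (auto simp: e_def)
      then have "y i \<in> ball (x i) (d i)"
        using y True by (force simp: coord_box_def dist_real_def abs_minus_commute)
      then show ?thesis using d by blast
    next
      case False
      then have "y i = x i"
        using y x W(2) by (auto simp: coord_box_def topspace_Euclidean_space)
      then show ?thesis using B(2) by auto
    qed
    then show "y \<in> U"
      using B(3) y W(2) by (auto simp: coord_box_def topspace_Euclidean_space)
  qed
  ultimately show ?thesis using that by blast
qed

lemma continuous_map_coord_box:
  assumes U: "openin (Euclidean_space n) U" and x: "x \<in> U"
    and f: "continuous_map (subtopology (Euclidean_space n) U) euclideanreal f" and e: "e > 0"
  obtains d where "d > 0" "\<And>y. y \<in> coord_box n x d \<Longrightarrow> \<bar>f y - f x\<bar> < e"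
proof -
  have "openin (subtopology (Euclidean_space n) U)
      {y \<in> topspace (subtopology (Euclidean_space n) U). f y \<in> ball (f x) e}"
    by (rule openin_continuous_map_preimage[OF f]) auto
  then have "openin (Euclidean_space n) {y \<in> U. f y \<in> ball (f x) e}"
    unfolding openin_open_subtopology[OF U] topspace_subtopology_subset[OF openin_subset[OF U]]
    by blast
  moreover have "x \<in> {y \<in> U. f y \<in> ball (f x) e}" using x e by auto
  ultimately obtain d where "d > 0" "coord_box n x d \<subseteq> {y \<in> U. f y \<in> ball (f x) e}"
    by (rule openin_contains_coord_box)
  then show ?thesis
    by (intro that[of d]) (auto simp: dist_real_def abs_minus_commute)
qed

text \<open>Partial derivatives evaluate a function at the points \<open>x(i := t)\<close>. Close to \<open>x\<close> these stay in an
  open \<open>U\<close>, which is why the smoothness predicates depend on the values on \<open>U\<close> alone.\<close>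

lemma eventually_update_in_open:
  assumes U: "openin (Euclidean_space n) U" and x: "x \<in> U" and i: "i < n"
  shows "\<forall>\<^sub>F t in nhds (x i). x(i := t) \<in> U"
proof -
  obtain e where e: "e > 0" "coord_box n x e \<subseteq> U"
    using openin_contains_coord_box[OF U x] .
  have x0: "x \<in> Rn n" using openin_subset[OF U] x by auto
  have "x(i := t) \<in> U" if "dist t (x i) < e" for t
    using that e x0 i
    by (intro subsetD[OF e(2)]) (auto simp: coord_box_def topspace_Euclidean_space dist_real_def)
  then show ?thesis using e(1) unfolding eventually_nhds_metric by blast
qed

text \<open>A curve may move a coordinate in either direction or leave it fixed, so the end points are
  not ordered and may coincide.\<close>

lemma MVT_closed_segment:
  fixes f f' :: "real \<Rightarrow> real"
  assumes "\<And>s. s \<in> closed_segment a b \<Longrightarrow> (f has_real_derivative f' s) (at s)"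
  shows "\<exists>s\<in>closed_segment a b. f b - f a = f' s * (b - a)"
proof (cases a b rule: linorder_cases)
  case less
  then obtain z where "a < z" "z < b" "f b - f a = (b - a) * f' z"
    using MVT2[of a b f f'] assms by (auto simp: closed_segment_eq_real_ivl)
  then show ?thesis by (intro bexI[of _ z]) (auto simp: closed_segment_eq_real_ivl)
next
  case greater
  then obtain z where "b < z" "z < a" "f a - f b = (a - b) * f' z"
    using MVT2[of b a f f'] assms by (auto simp: closed_segment_eq_real_ivl)
  then show ?thesis by (intro bexI[of _ z]) (auto simp: closed_segment_eq_real_ivl algebra_simps)
qed auto

lemma has_real_derivative_partial_deriv:
  assumes "(\<lambda>t. f (x(i := t))) field_differentiable at (x i)"
  shows "((\<lambda>t. f (x(i := t))) has_real_derivative partial_deriv i f x) (at (x i))"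
  using assms by (simp add: partial_deriv_def DERIV_deriv_iff_field_differentiable)

text \<open>The chain rule for a function with continuous partial derivatives. The increment of \<open>G\<close> along the
  curve telescopes into increments in which a single coordinate moves. By the mean value theorem the
  \<open>i\<close>-th of them is \<open>\<partial>\<^sub>iG\<close>, at a point that tends to \<open>c t0\<close>, times the increment of the coordinate \<open>i\<close>
  of the curve; continuity of \<open>\<partial>\<^sub>iG\<close> identifies the limit of the difference quotient.\<close>

lemma has_real_derivative_along_curve:
  fixes c :: "real \<Rightarrow> nat \<Rightarrow> real"
  assumes U: "openin (Euclidean_space n) U" and c0: "c t0 \<in> U"
    and diff: "\<And>i x. i < n \<Longrightarrow> x \<in> U \<Longrightarrow> (\<lambda>t. G (x(i := t))) field_differentiable at (x i)"
    and cont: "\<And>i. i < n \<Longrightarrow>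
      continuous_map (subtopology (Euclidean_space n) U) euclideanreal (partial_deriv i G)"
    and cU: "\<forall>\<^sub>F t in nhds t0. c t \<in> U"
    and c: "\<And>i. i < n \<Longrightarrow> ((\<lambda>t. c t i) has_real_derivative c' i) (at t0)"
  shows "((\<lambda>t. G (c t)) has_real_derivative (\<Sum>i<n. partial_deriv i G (c t0) * c' i)) (at t0)"
proof -
  \<comment> \<open>Move from \<open>c t0\<close> to \<open>c t\<close> one coordinate at a time: \<open>h i t\<close> has moved the first \<open>i\<close>.\<close>
  define h where "h i t = (\<lambda>l. if l < i then c t l else c t0 l)" for i t
  have UR: "U \<subseteq> Rn n" using openin_subset[OF U] .
  have h0: "h i t0 = c t0" for i by (auto simp: h_def)
  have hSuc: "h (Suc i) t = (h i t)(i := c t i)" for i t by (auto simp: h_def)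
  have hi: "h i t = (h i t)(i := c t0 i)" for i t by (auto simp: h_def)
  have near: "\<forall>\<^sub>F t in at t0. \<forall>l<n. \<bar>c t l - c t0 l\<bar> < d" if "d > 0" for d
  proof -
    have "\<forall>\<^sub>F t in at t0. \<bar>c t l - c t0 l\<bar> < d" if "l < n" for l
      using tendstoD[OF DERIV_isCont[OF c[OF that], unfolded isCont_def] \<open>d > 0\<close>]
      by (simp add: dist_real_def)
    then have "\<forall>\<^sub>F t in at t0. \<forall>l\<in>{..<n}. \<bar>c t l - c t0 l\<bar> < d"
      by (intro eventually_ball_finite) auto
    then show ?thesis by eventually_elim simp
  qed
  have box: "(h i t)(i := s) \<in> coord_box n (c t0) d"
    if "\<forall>l<n. \<bar>c t l - c t0 l\<bar> < d" "i < n" "s \<in> closed_segment (c t0 i) (c t i)" for i t s d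
  proof -
    have "\<bar>c t i - c t0 i\<bar> < d" using that by auto
    moreover have "\<bar>s - c t0 i\<bar> \<le> \<bar>c t i - c t0 i\<bar>"
      using that(3) by (auto simp: closed_segment_eq_real_ivl split: if_splits)
    ultimately show ?thesis
      using that c0 UR by (auto simp: coord_box_def h_def topspace_Euclidean_space)
  qed
  obtain e where e: "e > 0" "coord_box n (c t0) e \<subseteq> U"
    using openin_contains_coord_box[OF U c0] .
  have step: "((\<lambda>t. G (h (Suc i) t) - G (h i t)) has_real_derivative
      partial_deriv i G (c t0) * c' i) (at t0)" if i: "i < n" for i
  proof -
    have "\<exists>s. (\<forall>l<n. \<bar>c t l - c t0 l\<bar> < e) \<longrightarrow> s \<in> closed_segment (c t0 i) (c t i) \<and>
        G (h (Suc i) t) - G (h i t) = partial_deriv i G ((h i t)(i := s)) * (c t i - c t0 i)" for t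
    proof (cases "\<forall>l<n. \<bar>c t l - c t0 l\<bar> < e")
      case True
      have "((\<lambda>s. G ((h i t)(i := s))) has_real_derivative partial_deriv i G ((h i t)(i := s))) (at s)"
        if "s \<in> closed_segment (c t0 i) (c t i)" for s
      proof -
        have "(h i t)(i := s) \<in> U" using box[OF True i that] e(2) by blast
        from diff[OF i this] show ?thesis
          using has_real_derivative_partial_deriv[of G "(h i t)(i := s)" i] by simp
      qed
      then have "\<exists>s\<in>closed_segment (c t0 i) (c t i).
          G ((h i t)(i := c t i)) - G ((h i t)(i := c t0 i)) =
          partial_deriv i G ((h i t)(i := s)) * (c t i - c t0 i)"
        by (rule MVT_closed_segment)
      then show ?thesis
        by (auto simp: hSuc hi[symmetric])
    qed auto
    then obtain s where s: "\<And>t. (\<forall>l<n. \<bar>c t l - c t0 l\<bar> < e) \<Longrightarrow>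
          s t \<in> closed_segment (c t0 i) (c t i)"
        "\<And>t. (\<forall>l<n. \<bar>c t l - c t0 l\<bar> < e) \<Longrightarrow>
          G (h (Suc i) t) - G (h i t) = partial_deriv i G ((h i t)(i := s t)) * (c t i - c t0 i)"
      by metis
    have lim: "((\<lambda>t. partial_deriv i G ((h i t)(i := s t))) \<longlongrightarrow> partial_deriv i G (c t0)) (at t0)"
    proof (rule tendstoI)
      fix r :: real assume "r > 0"
      then obtain d where d: "d > 0"
        "\<And>y. y \<in> coord_box n (c t0) d \<Longrightarrow> \<bar>partial_deriv i G y - partial_deriv i G (c t0)\<bar> < r"
        using continuous_map_coord_box[OF U c0 cont[OF i]] by metis
      show "\<forall>\<^sub>F t in at t0. dist (partial_deriv i G ((h i t)(i := s t))) (partial_deriv i G (c t0)) < r"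
        using near[OF d(1)] near[OF e(1)]
      proof eventually_elim
        case (elim t)
        show ?case unfolding dist_real_def
          by (rule d(2), rule box) (use elim i s(1) in auto)
      qed
    qed
    have "((\<lambda>t. partial_deriv i G ((h i t)(i := s t)) * ((c t i - c t0 i) / (t - t0)))
        \<longlongrightarrow> partial_deriv i G (c t0) * c' i) (at t0)"
      using c[OF i] by (intro tendsto_mult lim) (simp add: has_field_derivative_iff)
    moreover have "\<forall>\<^sub>F t in at t0. partial_deriv i G ((h i t)(i := s t)) * ((c t i - c t0 i) / (t - t0))
        = ((G (h (Suc i) t) - G (h i t)) - (G (h (Suc i) t0) - G (h i t0))) / (t - t0)"
      using near[OF e(1)] by eventually_elim (simp add: s(2) h0)
    ultimately show ?thesis
      unfolding has_field_derivative_iff by (rule Lim_transform_eventually)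
  qed
  have "((\<lambda>t. \<Sum>i<n. G (h (Suc i) t) - G (h i t)) has_real_derivative
      (\<Sum>i<n. partial_deriv i G (c t0) * c' i)) (at t0)"
    by (intro DERIV_sum step) auto
  then have D: "((\<lambda>t. G (h n t) - G (h 0 t)) has_real_derivative
      (\<Sum>i<n. partial_deriv i G (c t0) * c' i)) (at t0)"
    unfolding sum_lessThan_telescope[of "\<lambda>i. G (h i t)" for t] .
  have "((\<lambda>t. (G (h n t) - G (h 0 t)) + G (c t0)) has_real_derivative
      (\<Sum>i<n. partial_deriv i G (c t0) * c' i)) (at t0)"
    using DERIV_add[OF D DERIV_const] by simp
  moreover have "\<forall>\<^sub>F t in nhds t0. (G (h n t) - G (h 0 t)) + G (c t0) = G (c t)"
    using cU
  proof eventually_elim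
    case (elim t)
    have "c t l = c t0 l" if "\<not> l < n" for l
    proof -
      have "c t \<in> Rn n" "c t0 \<in> Rn n" using elim c0 UR by auto
      then show ?thesis using that by (simp add: topspace_Euclidean_space)
    qed
    then have "h n t = c t" by (auto simp: h_def)
    moreover have "h 0 t = c t0" by (simp add: h_def)
    ultimately show ?case by simp
  qed
  ultimately show ?thesis
    by (subst (asm) DERIV_cong_ev[OF refl _ refl])
qed

lemma partial_deriv_cong_open:
  assumes U: "openin (Euclidean_space n) U" and x: "x \<in> U" and i: "i < n"
    and fg: "\<And>y. y \<in> U \<Longrightarrow> f y = g y"
  shows "((\<lambda>t. f (x(i := t))) has_real_derivative d) (at (x i)) \<longleftrightarrow>
      ((\<lambda>t. g (x(i := t))) has_real_derivative d) (at (x i))"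
    and "partial_deriv i f x = partial_deriv i g x"
proof -
  have ev: "\<forall>\<^sub>F t in nhds (x i). f (x(i := t)) = g (x(i := t))"
    using eventually_update_in_open[OF U x i] by eventually_elim (rule fg)
  show "((\<lambda>t. f (x(i := t))) has_real_derivative d) (at (x i)) \<longleftrightarrow>
      ((\<lambda>t. g (x(i := t))) has_real_derivative d) (at (x i))"
    by (rule DERIV_cong_ev[OF refl ev refl])
  show "partial_deriv i f x = partial_deriv i g x"
    unfolding partial_deriv_def by (rule deriv_cong_ev[OF ev refl])
qed

section \<open>Functions of class \<open>C\<^sup>k\<close> and smooth functions\<close>

lemma continuous_map_real_open_subset_iff:
  assumes "openin X U"
  shows "continuous_map (subtopology X U) euclideanreal f \<longleftrightarrow>
    (\<forall>W. open W \<longrightarrow> openin X {x \<in> U. f x \<in> W})"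
  unfolding continuous_map_def openin_open_subtopology[OF assms]
    topspace_subtopology_subset[OF openin_subset[OF assms]]
  by auto

lemma Ck_on_imp_continuous:
  "Ck_on k n U f \<Longrightarrow> continuous_map (subtopology (Euclidean_space n) U) euclideanreal f"
  by (cases k) auto

lemma Ck_on_cong:
  assumes U: "openin (Euclidean_space n) U"
    and "Ck_on k n U f" and "\<And>x. x \<in> U \<Longrightarrow> f x = g x"
  shows "Ck_on k n U g"
  using assms(2,3)
proof (induction k arbitrary: f g)
  case 0
  then show ?case by (auto intro: continuous_map_eq)
next
  case (Suc k)
  have "(\<lambda>t. g (x(i := t))) field_differentiable at (x i)" if "i < n" "x \<in> U" for i x
  proof -
    have "\<exists>d. ((\<lambda>t. f (x(i := t))) has_real_derivative d) (at (x i))"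
      using Suc.prems(1) that by (simp add: field_differentiable_def)
    then show ?thesis
      using partial_deriv_cong_open(1)[OF U that(2,1), of f g] Suc.prems(2)
      by (simp add: field_differentiable_def)
  qed
  moreover have "Ck_on k n U (partial_deriv i g)" if i: "i < n" for i
    using Suc.IH[of "partial_deriv i f"] Suc.prems i partial_deriv_cong_open(2)[OF U _ i, of _ f g]
    by auto
  moreover have "continuous_map (subtopology (Euclidean_space n) U) euclideanreal g"
    using Suc.prems by (auto intro: continuous_map_eq)
  ultimately show ?case by auto
qed

text \<open>Any functions that agree with the partial derivatives on \<open>U\<close> may serve as witnesses. The
  closure properties can thus name the derivative given by a rule of calculus, without regard to
  what \<^const>\<open>partial_deriv\<close> returns outside \<open>U\<close>.\<close>

lemma Ck_on_Suc_iff: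
  assumes U: "openin (Euclidean_space n) U"
  shows "Ck_on (Suc k) n U f \<longleftrightarrow>
    continuous_map (subtopology (Euclidean_space n) U) euclideanreal f \<and>
    (\<forall>i<n. \<exists>g. (\<forall>x\<in>U. ((\<lambda>t. f (x(i := t))) has_real_derivative g x) (at (x i))) \<and>
      Ck_on k n U g)"
    (is "?L \<longleftrightarrow> ?C \<and> ?R")
proof
  assume ?L
  then show "?C \<and> ?R" using has_real_derivative_partial_deriv by fastforce
next
  assume R: "?C \<and> ?R"
  have "(\<forall>x\<in>U. (\<lambda>t. f (x(i := t))) field_differentiable at (x i)) \<and> Ck_on k n U (partial_deriv i f)"
    if i: "i < n" for i
  proof -
    obtain g where g: "\<And>x. x \<in> U \<Longrightarrow> ((\<lambda>t. f (x(i := t))) has_real_derivative g x) (at (x i))"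
      and Ck: "Ck_on k n U g"
      using R i by blast
    have "partial_deriv i f x = g x" if "x \<in> U" for x
      unfolding partial_deriv_def by (rule DERIV_imp_deriv[OF g[OF that]])
    then have "Ck_on k n U (partial_deriv i f)"
      using Ck_on_cong[OF U Ck] by simp
    then show ?thesis using g by (auto simp: field_differentiable_def)
  qed
  then show ?L using R by simp
qed

lemma Ck_on_Suc_imp:
  "Ck_on (Suc k) n U f \<Longrightarrow> Ck_on k n U f"
proof (induction k arbitrary: f)
  case (Suc k)
  from Suc.prems have "Ck_on k n U (partial_deriv i f)" if "i < n" for i
    using Suc.IH that by (metis Ck_on.simps(2))
  then show ?case using Suc.prems by simp
qed simp

lemma Ck_on_const:
  assumes U: "openin (Euclidean_space n) U"
  shows "Ck_on k n U (\<lambda>x. a)"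
proof (induction k arbitrary: a)
  case (Suc k)
  then show ?case
    unfolding Ck_on_Suc_iff[OF U] by (auto intro!: exI[of _ "\<lambda>_. 0"])
qed simp

lemma Ck_on_add:
  assumes U: "openin (Euclidean_space n) U" and "Ck_on k n U f" "Ck_on k n U g"
  shows "Ck_on k n U (\<lambda>x. f x + g x)"
  using assms(2,3)
proof (induction k arbitrary: f g)
  case 0
  then show ?case by (simp add: continuous_map_add)
next
  case (Suc k)
  show ?case
    unfolding Ck_on_Suc_iff[OF U]
  proof (intro conjI allI impI)
    show "continuous_map (subtopology (Euclidean_space n) U) euclideanreal (\<lambda>x. f x + g x)"
      using Suc.prems by (simp add: continuous_map_add)
    fix i assume i: "i < n"
    obtain f' g' where *: "\<And>x. x \<in> U \<Longrightarrow> ((\<lambda>t. f (x(i := t))) has_real_derivative f' x) (at (x i))"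
      "\<And>x. x \<in> U \<Longrightarrow> ((\<lambda>t. g (x(i := t))) has_real_derivative g' x) (at (x i))"
      "Ck_on k n U f'" "Ck_on k n U g'"
      using Suc.prems i unfolding Ck_on_Suc_iff[OF U] by metis
    show "\<exists>d. (\<forall>x\<in>U. ((\<lambda>t. f (x(i := t)) + g (x(i := t))) has_real_derivative d x) (at (x i))) \<and>
        Ck_on k n U d"
      using * Suc.IH by (intro exI[of _ "\<lambda>x. f' x + g' x"]) (auto intro: DERIV_add)
  qed
qed

lemma Ck_on_mult:
  assumes U: "openin (Euclidean_space n) U" and "Ck_on k n U f" "Ck_on k n U g"
  shows "Ck_on k n U (\<lambda>x. f x * g x)"
  using assms(2,3)
proof (induction k arbitrary: f g)
  case 0
  then show ?case by (simp add: continuous_map_real_mult)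
next
  case (Suc k)
  show ?case
    unfolding Ck_on_Suc_iff[OF U]
  proof (intro conjI allI impI)
    show "continuous_map (subtopology (Euclidean_space n) U) euclideanreal (\<lambda>x. f x * g x)"
      using Suc.prems by (simp add: continuous_map_real_mult)
    fix i assume i: "i < n"
    obtain f' g' where *: "\<And>x. x \<in> U \<Longrightarrow> ((\<lambda>t. f (x(i := t))) has_real_derivative f' x) (at (x i))"
      "\<And>x. x \<in> U \<Longrightarrow> ((\<lambda>t. g (x(i := t))) has_real_derivative g' x) (at (x i))"
      "Ck_on k n U f'" "Ck_on k n U g'"
      using Suc.prems i unfolding Ck_on_Suc_iff[OF U] by metis
    have "((\<lambda>t. f (x(i := t)) * g (x(i := t))) has_real_derivative f' x * g x + g' x * f x) (at (x i))"
      if "x \<in> U" for x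
      using DERIV_mult[OF *(1,2)[OF that]] by simp
    moreover have "Ck_on k n U (\<lambda>x. f' x * g x + g' x * f x)"
      by (intro Ck_on_add[OF U] Suc.IH *(3,4) Suc.prems[THEN Ck_on_Suc_imp])
    ultimately show "\<exists>d. (\<forall>x\<in>U. ((\<lambda>t. f (x(i := t)) * g (x(i := t))) has_real_derivative d x) (at (x i))) \<and>
        Ck_on k n U d"
      by (intro exI conjI ballI)
  qed
qed

lemma Ck_on_sum:
  assumes U: "openin (Euclidean_space n) U" and "\<And>i. i \<in> I \<Longrightarrow> Ck_on k n U (f i)"
  shows "Ck_on k n U (\<lambda>x. \<Sum>i\<in>I. f i x)"
  using assms(2)
  by (induction I rule: infinite_finite_induct) (auto intro: Ck_on_const[OF U] Ck_on_add[OF U])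

lemma continuous_map_into_open_Euclidean:
  assumes U: "openin (Euclidean_space n) U" and F: "F \<in> topspace X \<rightarrow> U"
    and comp: "\<And>i. i < n \<Longrightarrow> continuous_map X euclideanreal (\<lambda>x. F x i)"
  shows "continuous_map X (subtopology (Euclidean_space n) U) F"
proof -
  have FR: "F x \<in> Rn n" if "x \<in> topspace X" for x
    using F openin_subset[OF U] that by blast
  have "continuous_map X (Euclidean_space n) (\<lambda>x i. if i < n then F x i else 0)"
    using comp by (simp add: continuous_map_componentwise_Euclidean_space)
  moreover have "(\<lambda>i. if i < n then F x i else 0) = F x" if "x \<in> topspace X" for x
    using FR[OF that] by (auto simp: topspace_Euclidean_space)
  ultimately have "continuous_map X (Euclidean_space n) F"
    using continuous_map_eq by blast
  then show ?thesis using F by (auto simp: continuous_map_in_subtopology)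
qed

text \<open>Induction on the order: \<open>\<partial>\<^sub>j(G \<circ> F)\<close> is the sum of the products \<open>(\<partial>\<^sub>iG \<circ> F) \<cdot> \<partial>\<^sub>jF\<^sub>i\<close>, where \<open>\<partial>\<^sub>iG\<close> and
  \<open>\<partial>\<^sub>jF\<^sub>i\<close> have one order of differentiability less. The induction hypothesis is needed for all \<open>G\<close>
  at once.\<close>

lemma Ck_on_compose:
  assumes V: "openin (Euclidean_space m) V" and U: "openin (Euclidean_space n) U"
    and FU: "F \<in> V \<rightarrow> U" and F: "\<And>i. i < n \<Longrightarrow> Ck_on k m V (\<lambda>x. F x i)" and G: "Ck_on k n U G"
  shows "Ck_on k m V (\<lambda>x. G (F x))"
  using F G
proof (induction k arbitrary: G)
  case 0
  then have "continuous_map (subtopology (Euclidean_space m) V) (subtopology (Euclidean_space n) U) F"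
    using FU by (intro continuous_map_into_open_Euclidean[OF U]) auto
  then show ?case
    using 0 continuous_map_compose by (fastforce simp: o_def)
next
  case (Suc k)
  have GS: "Ck_on (Suc k) n U G" by (rule Suc.prems)
  have F: "Ck_on k m V (\<lambda>x. F x i)" if "i < n" for i
    using Suc.prems(1) Ck_on_Suc_imp that by blast
  show ?case
    unfolding Ck_on_Suc_iff[OF V]
  proof (intro conjI allI impI)
    show "continuous_map (subtopology (Euclidean_space m) V) euclideanreal (\<lambda>x. G (F x))"
      using Suc.IH[OF F Ck_on_Suc_imp[OF GS]] by (rule Ck_on_imp_continuous) 
    fix j assume j: "j < m"
    have "\<forall>i\<in>{..<n}. \<exists>f'. (\<forall>x\<in>V. ((\<lambda>t. F (x(j := t)) i) has_real_derivative f' x) (at (x j))) \<and>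
        Ck_on k m V f'"
      using Suc.prems(1) j unfolding Ck_on_Suc_iff[OF V] by blast
    then obtain F' where F':
      "\<And>i x. i < n \<Longrightarrow> x \<in> V \<Longrightarrow> ((\<lambda>t. F (x(j := t)) i) has_real_derivative F' i x) (at (x j))"
      "\<And>i. i < n \<Longrightarrow> Ck_on k m V (F' i)"
      unfolding bchoice_iff by auto
    have "((\<lambda>t. G (F (x(j := t)))) has_real_derivative
        (\<Sum>i<n. partial_deriv i G (F x) * F' i x)) (at (x j))" if x: "x \<in> V" for x
    proof -
      have "((\<lambda>t. G (F (x(j := t)))) has_real_derivative
          (\<Sum>i<n. partial_deriv i G (F (x(j := x j))) * F' i x)) (at (x j))"
      proof (rule has_real_derivative_along_curve[OF U])
        show "F (x(j := x j)) \<in> U" using FU x by auto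
        show "\<forall>\<^sub>F t in nhds (x j). F (x(j := t)) \<in> U"
          using eventually_update_in_open[OF V x j] by eventually_elim (use FU in auto)
        show "continuous_map (subtopology (Euclidean_space n) U) euclideanreal (partial_deriv i G)"
          if "i < n" for i
          using GS that Ck_on_imp_continuous by auto
        show "(\<lambda>t. G (y(i := t))) field_differentiable at (y i)" if "i < n" "y \<in> U" for i y
          using GS that by simp
        show "((\<lambda>t. F (x(j := t)) i) has_real_derivative F' i x) (at (x j))" if "i < n" for i
          by (rule F'(1)[OF that x])
      qed
      then show ?thesis by simp
    qed
    moreover have "Ck_on k m V (\<lambda>x. \<Sum>i<n. partial_deriv i G (F x) * F' i x)"
    proof (rule Ck_on_sum[OF V], rule Ck_on_mult[OF V])
      fix i assume "i \<in> {..<n}"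
      then have i: "i < n" by simp
      show "Ck_on k m V (\<lambda>x. partial_deriv i G (F x))"
        using GS i by (intro Suc.IH[OF F]) auto
      show "Ck_on k m V (F' i)" by (rule F'(2)[OF i])
    qed
    ultimately show "\<exists>g. (\<forall>x\<in>V. ((\<lambda>t. G (F (x(j := t)))) has_real_derivative g x) (at (x j))) \<and>
        Ck_on k m V g"
      by (intro exI conjI ballI)
  qed
qed

lemma Ck_on_subset:
  assumes "V \<subseteq> U" "Ck_on k n U f"
  shows "Ck_on k n V f"
  using assms(2)
proof (induction k arbitrary: f)
  case 0
  then show ?case
    using continuous_map_from_subtopology_mono[OF Ck_on_imp_continuous[OF 0] assms(1)] by simp
next
  case (Suc k)
  have "continuous_map (subtopology (Euclidean_space n) V) euclideanreal f"
    using continuous_map_from_subtopology_mono[OF Ck_on_imp_continuous[OF Suc.prems] assms(1)] .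
  then show ?case using Suc.IH Suc.prems assms(1) by auto
qed

text \<open>A neighbourhood on which \<open>f\<close> is of class \<open>C\<^sup>k\<^sup>+\<^sup>1\<close> serves for its partial derivatives at order \<open>k\<close>,
  so the induction reduces everything to the locality of continuity.\<close>

lemma Ck_on_locally:
  assumes U: "openin (Euclidean_space n) U"
    and "\<And>x. x \<in> U \<Longrightarrow> \<exists>V. openin (Euclidean_space n) V \<and> x \<in> V \<and> V \<subseteq> U \<and> Ck_on k n V f"
  shows "Ck_on k n U f"
  using assms(2)
proof (induction k arbitrary: f)
  have cont: "continuous_map (subtopology (Euclidean_space n) U) euclideanreal f"
    if loc: "\<And>x. x \<in> U \<Longrightarrow> \<exists>V. openin (Euclidean_space n) V \<and> x \<in> V \<and> V \<subseteq> U \<and>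
      continuous_map (subtopology (Euclidean_space n) V) euclideanreal f" for f
    unfolding continuous_map_real_open_subset_iff[OF U]
  proof (intro allI impI)
    fix W :: "real set" assume W: "open W"
    show "openin (Euclidean_space n) {x \<in> U. f x \<in> W}"
    proof (subst openin_subopen, intro ballI)
      fix x assume x: "x \<in> {x \<in> U. f x \<in> W}"
      then obtain V where V: "openin (Euclidean_space n) V" "x \<in> V" "V \<subseteq> U"
        "continuous_map (subtopology (Euclidean_space n) V) euclideanreal f"
        using loc by blast
      then have "openin (Euclidean_space n) {y \<in> V. f y \<in> W}"
        using W continuous_map_real_open_subset_iff by blast
      then show "\<exists>T. openin (Euclidean_space n) T \<and> x \<in> T \<and> T \<subseteq> {x \<in> U. f x \<in> W}"
        using V x by (intro exI[of _ "{y \<in> V. f y \<in> W}"]) auto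
    qed
  qed
  { case 0
    then show ?case using cont by simp
  next
    case (Suc k)
    have "continuous_map (subtopology (Euclidean_space n) U) euclideanreal f"
      using Suc.prems by (intro cont) (meson Ck_on_imp_continuous)
    moreover have "(\<lambda>t. f (x(i := t))) field_differentiable at (x i)"
      if x: "x \<in> U" and i: "i < n" for x i
    proof -
      obtain V where "x \<in> V" "Ck_on (Suc k) n V f" using Suc.prems[OF x] by blast
      then show ?thesis using i by simp
    qed
    moreover have "Ck_on k n U (partial_deriv i f)" if "i < n" for i
    proof (rule Suc.IH)
      fix x assume "x \<in> U"
      then obtain V where "openin (Euclidean_space n) V" "x \<in> V" "V \<subseteq> U" "Ck_on (Suc k) n V f"
        using Suc.prems by blast
      then show "\<exists>V. openin (Euclidean_space n) V \<and> x \<in> V \<and> V \<subseteq> U \<and>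
          Ck_on k n V (partial_deriv i f)"
        using that by (intro exI[of _ V]) simp
    qed
    ultimately show ?case by simp }
qed

lemma smooth_fun_imp_continuous:
  assumes "smooth_fun n U f"
  shows "continuous_map (subtopology (Euclidean_space n) U) euclideanreal f"
proof -
  have "Ck_on 0 n U f" using assms unfolding smooth_fun_def by (rule spec)
  then show ?thesis by simp
qed

lemma smooth_fun_cong:
  assumes U: "openin (Euclidean_space n) U" and eq: "\<And>x. x \<in> U \<Longrightarrow> f x = g x"
    and f: "smooth_fun n U f"
  shows "smooth_fun n U g"
  unfolding smooth_fun_def
proof
  fix k
  have "Ck_on k n U f" using f by (simp add: smooth_fun_def)
  then show "Ck_on k n U g" by (rule Ck_on_cong[OF U _ eq])
qed

lemma smooth_fun_const: "openin (Euclidean_space n) U \<Longrightarrow> smooth_fun n U (\<lambda>x. a)"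
  by (simp add: smooth_fun_def Ck_on_const)

lemma smooth_fun_subset: "V \<subseteq> U \<Longrightarrow> smooth_fun n U f \<Longrightarrow> smooth_fun n V f"
  by (simp add: smooth_fun_def Ck_on_subset)

lemma smooth_fun_locally:
  assumes U: "openin (Euclidean_space n) U"
    and loc: "\<And>x. x \<in> U \<Longrightarrow>
      \<exists>V. openin (Euclidean_space n) V \<and> x \<in> V \<and> V \<subseteq> U \<and> smooth_fun n V f"
  shows "smooth_fun n U f"
  unfolding smooth_fun_def
proof
  fix k
  have "\<exists>V. openin (Euclidean_space n) V \<and> x \<in> V \<and> V \<subseteq> U \<and> Ck_on k n V f" if "x \<in> U" for x
    using loc[OF that] by (auto simp: smooth_fun_def)
  then show "Ck_on k n U f" by (rule Ck_on_locally[OF U])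
qed

lemma smooth_fun_compose:
  assumes V: "openin (Euclidean_space m) V" and U: "openin (Euclidean_space n) U"
    and F: "smooth_map m V n U F" and G: "smooth_fun n U G"
  shows "smooth_fun m V (\<lambda>x. G (F x))"
  unfolding smooth_fun_def
proof
  fix k
  show "Ck_on k m V (\<lambda>x. G (F x))"
    using F G by (intro Ck_on_compose[OF V U, of F k G]) (auto simp: smooth_map_def smooth_fun_def)
qed

section \<open>The Galois connection between \<open>\<Phi>\<close> and \<open>\<Pi>\<close>\<close>

lemma Phi_antimono: "D \<subseteq> E \<Longrightarrow> Phi X E \<subseteq> Phi X D"
  by (auto simp: Phi_def)

lemma Pai_antimono: "A \<subseteq> B \<Longrightarrow> Pai X B \<subseteq> Pai X A"
  by (auto simp: Pai_def)

lemma subset_Pai_Phi: "D \<subseteq> params X \<Longrightarrow> D \<subseteq> Pai X (Phi X D)"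
  by (auto simp: Phi_def Pai_def)

lemma subset_Phi_Pai: "A \<subseteq> real_funs X \<Longrightarrow> A \<subseteq> Phi X (Pai X A)"
  by (auto simp: Phi_def Pai_def)

lemma Phi_Pai_Phi:
  assumes "D \<subseteq> params X"
  shows "Phi X (Pai X (Phi X D)) = Phi X D"
proof
  show "Phi X (Pai X (Phi X D)) \<subseteq> Phi X D"
    by (intro Phi_antimono subset_Pai_Phi assms)
  show "Phi X D \<subseteq> Phi X (Pai X (Phi X D))"
    by (intro subset_Phi_Pai) (auto simp: Phi_def)
qed

lemma Pai_Phi_Pai:
  assumes "A \<subseteq> real_funs X"
  shows "Pai X (Phi X (Pai X A)) = Pai X A"
proof
  show "Pai X (Phi X (Pai X A)) \<subseteq> Pai X A"
    by (intro Pai_antimono subset_Phi_Pai assms)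
  show "Pai X A \<subseteq> Pai X (Phi X (Pai X A))"
    by (intro subset_Pai_Phi) (auto simp: Pai_def)
qed

section \<open>The structures induced by \<open>\<Phi>\<close> and \<open>\<Pi>\<close>\<close>

text \<open>Sets \<open>{x. f x \<in> W}\<close> generate the initial topology, and their preimages under \<open>p\<close> are open because
  \<open>f \<circ> p\<close>, being smooth, is continuous.\<close>

lemma continuous_map_plot:
  assumes p: "(n, U, p) \<in> params X" and smooth: "\<And>f. f \<in> A \<Longrightarrow> smooth_fun n U (f \<circ> p)"
  shows "continuous_map (subtopology (Euclidean_space n) U) (initial_topology X A) p"
proof -
  have U: "openin (Euclidean_space n) U" and pX: "p \<in> U \<rightarrow> X"
    using p by (auto simp: params_def)
  have top: "topspace (subtopology (Euclidean_space n) U) = U"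
    by (rule topspace_subtopology_subset[OF openin_subset[OF U]])
  have "openin (subtopology (Euclidean_space n) U) (p -` S \<inter> U)"
    if S: "S \<in> insert X {{x \<in> X. f x \<in> W} |f W. f \<in> A \<and> open W}" for S
  proof -
    consider "S = X" | f W where "S = {x \<in> X. f x \<in> W}" "f \<in> A" "open W"
      using S by auto
    then show ?thesis
    proof cases
      case 1
      then have "p -` S \<inter> U = U" using pX by auto
      then show ?thesis using top openin_topspace by metis
    next
      case 2
      then have "p -` S \<inter> U = {u \<in> U. (f \<circ> p) u \<in> W}" using pX by auto
      moreover have "openin (subtopology (Euclidean_space n) U)
          {u \<in> topspace (subtopology (Euclidean_space n) U). (f \<circ> p) u \<in> W}"
        by (rule openin_continuous_map_preimage[OF smooth_fun_imp_continuous[OF smooth]])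
          (use 2 in auto)
      ultimately show ?thesis by (simp only: top)
    qed
  qed
  then show ?thesis
    unfolding initial_topology_def using top pX
    by (intro continuous_on_generated_topo) auto
qed

text \<open>Smooth compatibility is the chain rule applied to \<open>(f\<^sub>1 \<circ> p, \<dots>, f\<^sub>k \<circ> p)\<close>. For locality, a function
  that agrees locally with members of \<open>\<Phi>D\<close> is pulled back by a plot; since plots are continuous,
  the pullback agrees with smooth functions on open subsets of the domain.\<close>

lemma is_differential_structure_Phi:
  assumes D: "D \<subseteq> params X"
  shows "is_differential_structure X (Phi X D)"
  unfolding is_differential_structure_def
proof (intro conjI allI impI ballI)
  have open_dom: "openin (Euclidean_space n) U" and val: "u \<in> U \<Longrightarrow> p u \<in> X"
    if "(n, U, p) \<in> D" for n U p u
    using that D by (auto simp: params_def)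
  have "(\<lambda>x\<in>X. 0) \<in> Phi X D"
  proof -
    have "smooth_fun n U ((\<lambda>x\<in>X. 0) \<circ> p)" if "(n, U, p) \<in> D" for n U p
      by (rule smooth_fun_cong[OF open_dom[OF that] _ smooth_fun_const[OF open_dom[OF that], of 0]])
        (use val[OF that] in auto)
    then show ?thesis by (auto simp: Phi_def real_funs_def)
  qed
  then show "Phi X D \<noteq> {}" by blast
  show "Phi X D \<subseteq> real_funs X" by (auto simp: Phi_def)
  show "(\<lambda>x\<in>X. G (\<lambda>i. if i < k then f i x else 0)) \<in> Phi X D"
    if fG: "(\<forall>i<k. f i \<in> Phi X D) \<and> smooth_fun k (Rn k) G" for k f G
  proof -
    have "smooth_fun n U ((\<lambda>x\<in>X. G (\<lambda>i. if i < k then f i x else 0)) \<circ> p)"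
      if p: "(n, U, p) \<in> D" for n U p
    proof -
      have "smooth_fun n U (f i \<circ> p)" if "i < k" for i
        using fG that p by (auto simp: Phi_def)
      then have "smooth_map n U k (Rn k) (\<lambda>u i. if i < k then f i (p u) else 0)"
        by (auto simp: smooth_map_def topspace_Euclidean_space o_def)
      then have "smooth_fun n U (\<lambda>u. G (\<lambda>i. if i < k then f i (p u) else 0))"
        using fG by (intro smooth_fun_compose[OF open_dom[OF p], of k "Rn k"]) auto
      then show ?thesis
        by (rule smooth_fun_cong[OF open_dom[OF p], rotated]) (simp add: val[OF p])
    qed
    then show ?thesis by (auto simp: Phi_def real_funs_def)
  qed
  show "f \<in> Phi X D"
    if f: "f \<in> real_funs X"
      and loc: "\<forall>x\<in>X. \<exists>U g. openin (initial_topology X (Phi X D)) U \<and> x \<in> U \<and> g \<in> Phi X D \<and>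
        (\<forall>y\<in>U. f y = g y)" for f
  proof -
    have "smooth_fun n U (f \<circ> p)" if p: "(n, U, p) \<in> D" for n U p
    proof (rule smooth_fun_locally[OF open_dom[OF p]])
      fix u assume u: "u \<in> U"
      obtain W g where W: "openin (initial_topology X (Phi X D)) W" "p u \<in> W"
        and g: "g \<in> Phi X D" and eq: "\<And>y. y \<in> W \<Longrightarrow> f y = g y"
        using loc val[OF p u] by metis
      define V where "V = {v \<in> U. p v \<in> W}"
      have "continuous_map (subtopology (Euclidean_space n) U) (initial_topology X (Phi X D)) p"
        by (rule continuous_map_plot) (use p D in \<open>auto simp: Phi_def\<close>)
      from openin_continuous_map_preimage[OF this W(1)]
      have V: "openin (Euclidean_space n) V"
        unfolding V_def openin_open_subtopology[OF open_dom[OF p]]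
          topspace_subtopology_subset[OF openin_subset[OF open_dom[OF p]]]
        by blast
      have "smooth_fun n V (g \<circ> p)"
        using g p by (intro smooth_fun_subset[of V U]) (auto simp: Phi_def V_def)
      then have "smooth_fun n V (f \<circ> p)"
        by (rule smooth_fun_cong[OF V, rotated]) (auto simp: V_def eq)
      then show "\<exists>V. openin (Euclidean_space n) V \<and> u \<in> V \<and> V \<subseteq> U \<and> smooth_fun n V (f \<circ> p)"
        using V u W(2) by (intro exI[of _ V]) (auto simp: V_def)
    qed
    then show ?thesis using f by (auto simp: Phi_def)
  qed
qed

text \<open>Each axiom reflects a property of smooth real functions on open sets: constants are smooth,
  smoothness is local, and composites of smooth maps are smooth.\<close>

lemma is_diffeology_Pai: "is_diffeology X (Pai X A)"
  unfolding is_diffeology_def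
proof (intro conjI allI impI ballI)
  show "Pai X A \<subseteq> params X" by (auto simp: Pai_def)
next
  fix x n assume x: "x \<in> X"
  have o: "openin (Euclidean_space n) (Rn n)" by simp
  have "smooth_fun n (Rn n) (f \<circ> (\<lambda>u\<in>Rn n. x))" for f :: "'a \<Rightarrow> real"
    by (rule smooth_fun_cong[OF o _ smooth_fun_const[OF o, of "f x"]]) auto
  then show "(n, Rn n, \<lambda>u\<in>Rn n. x) \<in> Pai X A"
    using x by (auto simp: Pai_def params_def)
next
  fix n U p
  assume *: "(n, U, p) \<in> params X \<and> (\<forall>u\<in>U. \<exists>V. openin (Euclidean_space n) V \<and> u \<in> V \<and> V \<subseteq> U \<and>
    (n, V, restrict p V) \<in> Pai X A)"
  then have U: "openin (Euclidean_space n) U" by (auto simp: params_def)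
  have "smooth_fun n U (f \<circ> p)" if f: "f \<in> A" for f
  proof (rule smooth_fun_locally[OF U])
    fix u assume "u \<in> U"
    then obtain V where V: "openin (Euclidean_space n) V" "u \<in> V" "V \<subseteq> U"
      and "(n, V, restrict p V) \<in> Pai X A"
      using * by blast
    then have "smooth_fun n V (f \<circ> restrict p V)" using f by (auto simp: Pai_def)
    then have "smooth_fun n V (f \<circ> p)" by (rule smooth_fun_cong[OF V(1), rotated]) auto
    then show "\<exists>V. openin (Euclidean_space n) V \<and> u \<in> V \<and> V \<subseteq> U \<and> smooth_fun n V (f \<circ> p)"
      using V by blast
  qed
  then show "(n, U, p) \<in> Pai X A" using * by (auto simp: Pai_def)
next
  fix n U p m V F
  assume *: "(n, U, p) \<in> Pai X A \<and> openin (Euclidean_space m) V \<and> smooth_map m V n U F"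
  then have U: "openin (Euclidean_space n) U" and V: "openin (Euclidean_space m) V"
    and F: "F \<in> V \<rightarrow> U" and p: "p \<in> U \<rightarrow>\<^sub>E X"
    by (auto simp: Pai_def params_def smooth_map_def)
  have "smooth_fun m V (f \<circ> compose V p F)" if "f \<in> A" for f
  proof -
    have "smooth_fun m V (\<lambda>v. (f \<circ> p) (F v))"
      using * that by (intro smooth_fun_compose[OF V U, of F "f \<circ> p"]) (auto simp: Pai_def)
    then show ?thesis by (rule smooth_fun_cong[OF V, rotated]) (simp add: compose_eq)
  qed
  moreover have "compose V p F \<in> V \<rightarrow>\<^sub>E X"
    using F p by (auto simp: compose_def)
  ultimately show "(m, V, compose V p F) \<in> Pai X A"
    using V by (auto simp: Pai_def params_def)
qed

text \<open>Both implications between the two kinds of smooth map come from reading \<open>f \<circ> F \<circ> p\<close> either as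
  \<open>f\<close> after the plot \<open>F \<circ> p\<close> or as the function \<open>f \<circ> F\<close> after \<open>p\<close>.\<close>

lemma dsmooth_imp_fsmooth_Phi:
  assumes D: "D \<subseteq> params X" and F: "F \<in> dsmooth (X, D) (Y, E)"
  shows "F \<in> fsmooth (X, Phi X D) (Y, Phi Y E)"
proof -
  have FXY: "F \<in> X \<rightarrow>\<^sub>E Y" using F by (simp add: dsmooth_def)
  have "smooth_fun n U (compose X f F \<circ> p)" if f: "f \<in> Phi Y E" and p: "(n, U, p) \<in> D" for f n U p
  proof -
    have U: "openin (Euclidean_space n) U" and pX: "p \<in> U \<rightarrow> X"
      using p D by (auto simp: params_def)
    have "(n, U, compose U F p) \<in> E" using F p by (auto simp: dsmooth_def)
    then have "smooth_fun n U (f \<circ> compose U F p)" using f by (auto simp: Phi_def)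
    then show ?thesis
      by (rule smooth_fun_cong[OF U, rotated]) (use pX in \<open>auto simp: compose_def\<close>)
  qed
  moreover have "compose X f F \<in> real_funs X" for f :: "'a \<Rightarrow> real"
    by (auto simp: real_funs_def compose_def)
  ultimately show ?thesis using FXY by (auto simp: fsmooth_def Phi_def)
qed

lemma fsmooth_imp_dsmooth_Pai:
  assumes F: "F \<in> fsmooth (X, A) (Y, B)"
  shows "F \<in> dsmooth (X, Pai X A) (Y, Pai Y B)"
proof -
  have FXY: "F \<in> X \<rightarrow>\<^sub>E Y" using F by (simp add: fsmooth_def)
  have "(n, U, compose U F p) \<in> Pai Y B" if p: "(n, U, p) \<in> Pai X A" for n U p
  proof -
    have U: "openin (Euclidean_space n) U" and pX: "p \<in> U \<rightarrow> X"
      using p by (auto simp: Pai_def params_def)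
    have "smooth_fun n U (f \<circ> compose U F p)" if "f \<in> B" for f
    proof -
      have "compose X f F \<in> A" using F that by (auto simp: fsmooth_def)
      then have "smooth_fun n U (compose X f F \<circ> p)" using p by (auto simp: Pai_def)
      then show ?thesis
        by (rule smooth_fun_cong[OF U, rotated]) (use pX in \<open>auto simp: compose_def\<close>)
    qed
    moreover have "compose U F p \<in> U \<rightarrow>\<^sub>E Y"
      using pX FXY by (auto simp: compose_def)
    ultimately show ?thesis using U by (auto simp: Pai_def params_def)
  qed
  then show ?thesis using FXY by (auto simp: dsmooth_def)
qed

section \<open>Categories of structured sets\<close>

text \<open>The conditions on a class of spaces and its maps under which \<^const>\<open>concrete_category\<close> is a
  category.\<close>

definition structured_sets :: "('a set \<times> 's \<Rightarrow> bool) \<Rightarrow>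
    ('a set \<times> 's \<Rightarrow> 'a set \<times> 's \<Rightarrow> ('a \<Rightarrow> 'a) set) \<Rightarrow> bool"
  where "structured_sets P H \<longleftrightarrow>
    (\<forall>S T. P S \<and> P T \<longrightarrow> H S T \<subseteq> fst S \<rightarrow>\<^sub>E fst T) \<and>
    (\<forall>S. P S \<longrightarrow> (\<lambda>x\<in>fst S. x) \<in> H S S) \<and>
    (\<forall>R S T F G. P R \<and> P S \<and> P T \<and> F \<in> H R S \<and> G \<in> H S T \<longrightarrow> compose (fst R) G F \<in> H R T)"

lemma structured_sets_subclass: "structured_sets P H \<Longrightarrow> structured_sets (\<lambda>S. P S \<and> Q S) H"
  unfolding structured_sets_def by meson

lemma is_category_concrete_category:
  assumes "structured_sets P H"
  shows "is_category (concrete_category P H)"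
proof -
  have maps: "F \<in> fst S \<rightarrow>\<^sub>E fst T" if "P S" "P T" "F \<in> H S T" for S T F
    using assms that unfolding structured_sets_def by blast
  have "compose (fst S) F (\<lambda>x\<in>fst S. x) = F" if "P S" "P T" "F \<in> H S T" for S T F
    using maps[OF that] by (auto simp: compose_def fun_eq_iff)
  moreover have "compose (fst S) (\<lambda>x\<in>fst T. x) F = F" if "P S" "P T" "F \<in> H S T" for S T F
    using maps[OF that] by (fastforce simp: compose_def fun_eq_iff)
  moreover have "compose (fst R) G (compose (fst R) F E) = compose (fst R) (compose (fst S) G F) E"
    if "P R" "P S" "E \<in> H R S" for R S E F G
    using maps[OF that] by (auto simp: compose_def fun_eq_iff)
  moreover have "(\<lambda>x\<in>fst S. x) \<in> H S S" if "P S" for S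
    using assms that unfolding structured_sets_def by blast
  moreover have "compose (fst R) G F \<in> H R T" if "P R" "P S" "P T" "F \<in> H R S" "G \<in> H S T" for R S T F G
    using assms that unfolding structured_sets_def by blast
  ultimately show ?thesis
    unfolding is_category_def concrete_category_def by auto
qed

lemma full_subcategory_concrete_category:
  "full_subcategory (concrete_category P H) Q = concrete_category (\<lambda>S. P S \<and> Q S) H"
  by (auto simp: full_subcategory_def concrete_category_def)

text \<open>The functor that replaces the structure on each space by way of \<open>\<phi>\<close> and leaves the underlying
  functions alone. The functors \<open>\<Phi>\<close> and \<open>\<Pi>\<close>, and their restrictions, have this form.\<close>

definition restructure ::
  "('a set \<times> 's \<Rightarrow> bool) \<Rightarrow> ('a set \<times> 's \<Rightarrow> 'a set \<times> 's \<Rightarrow> ('a \<Rightarrow> 'a) set) \<Rightarrow>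
    ('a set \<times> 's \<Rightarrow> 'a set \<times> 't) \<Rightarrow>
    ('a set \<times> 's, ('a, 's) space_arr, 'a set \<times> 't, ('a, 't) space_arr) cfunctor"
  where "restructure P H \<phi> =
    \<lparr>FObj = restrict \<phi> (Obj (concrete_category P H)),
     FArr = (\<lambda>(S, F, T)\<in>Arr (concrete_category P H). (\<phi> S, F, \<phi> T))\<rparr>"

lemma restrict_functor_restructure:
  "restrict_functor (restructure P H \<phi>) (concrete_category (\<lambda>S. P S \<and> Q S) H) =
    restructure (\<lambda>S. P S \<and> Q S) H \<phi>"
  by (auto simp: restrict_functor_def restructure_def concrete_category_def fun_eq_iff)

lemma is_functor_restructure:
  assumes "structured_sets P H" "structured_sets Q K"
    and obj: "\<And>S. P S \<Longrightarrow> Q (\<phi> S)" and carrier: "\<And>S. P S \<Longrightarrow> fst (\<phi> S) = fst S"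
    and maps: "\<And>S T F. P S \<Longrightarrow> P T \<Longrightarrow> F \<in> H S T \<Longrightarrow> F \<in> K (\<phi> S) (\<phi> T)"
  shows "is_functor (concrete_category P H) (concrete_category Q K) (restructure P H \<phi>)"
proof -
  note cats = assms(1,2)[THEN is_category_concrete_category]
  have ident: "Ident (concrete_category P H) S \<in> Arr (concrete_category P H)" if "P S" for S
  proof -
    have "S \<in> Obj (concrete_category P H)" using that by (simp add: concrete_category_def)
    then show ?thesis using cats(1) unfolding is_category_def by blast
  qed
  have comp: "Comp (concrete_category P H) g f \<in> Arr (concrete_category P H)"
    if "f \<in> Arr (concrete_category P H)" "g \<in> Arr (concrete_category P H)"
      "Cod (concrete_category P H) f = Dom (concrete_category P H) g" for f g
    using cats(1) that unfolding is_category_def by blast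
  show ?thesis
    unfolding is_functor_def
  proof (intro conjI ballI impI)
    show "FArr (restructure P H \<phi>) (Ident (concrete_category P H) S) =
        Ident (concrete_category Q K) (FObj (restructure P H \<phi>) S)"
      if "S \<in> Obj (concrete_category P H)" for S
      using that ident[of S] carrier[of S] by (auto simp: restructure_def concrete_category_def)
    show "FArr (restructure P H \<phi>) (Comp (concrete_category P H) g f) =
        Comp (concrete_category Q K) (FArr (restructure P H \<phi>) g) (FArr (restructure P H \<phi>) f)"
      if "f \<in> Arr (concrete_category P H)" "g \<in> Arr (concrete_category P H)"
        "Cod (concrete_category P H) f = Dom (concrete_category P H) g" for f g
      using that comp[OF that] carrier
      by (cases f; cases g) (auto simp: restructure_def concrete_category_def)
  qed (use cats obj maps in \<open>auto simp: restructure_def concrete_category_def\<close>)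
qed

text \<open>Since underlying functions do not change, it is enough that \<open>\<phi>\<close> and \<open>\<psi>\<close> are mutually inverse on
  objects and that both preserve morphisms.\<close>

lemma inverse_functors_restructure:
  assumes "structured_sets P H" "structured_sets Q K"
    and "\<And>S. P S \<Longrightarrow> Q (\<phi> S)" "\<And>S. P S \<Longrightarrow> fst (\<phi> S) = fst S"
      "\<And>S T F. P S \<Longrightarrow> P T \<Longrightarrow> F \<in> H S T \<Longrightarrow> F \<in> K (\<phi> S) (\<phi> T)" "\<And>S. P S \<Longrightarrow> \<psi> (\<phi> S) = S"
    and "\<And>S. Q S \<Longrightarrow> P (\<psi> S)" "\<And>S. Q S \<Longrightarrow> fst (\<psi> S) = fst S"
      "\<And>S T F. Q S \<Longrightarrow> Q T \<Longrightarrow> F \<in> K S T \<Longrightarrow> F \<in> H (\<psi> S) (\<psi> T)" "\<And>S. Q S \<Longrightarrow> \<phi> (\<psi> S) = S"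
  shows "inverse_functors (concrete_category P H) (concrete_category Q K)
    (restructure P H \<phi>) (restructure Q K \<psi>)"
proof -
  \<comment> \<open>Stated for arbitrary classes of spaces because both composites are instances of it.\<close>
  have inv: "comp_functor (concrete_category P H) (restructure Q K \<psi>) (restructure P H \<phi>) =
      id_functor (concrete_category P H)"
    if "\<And>S. P S \<Longrightarrow> Q (\<phi> S)" "\<And>S T F. P S \<Longrightarrow> P T \<Longrightarrow> F \<in> H S T \<Longrightarrow> F \<in> K (\<phi> S) (\<phi> T)"
      "\<And>S. P S \<Longrightarrow> \<psi> (\<phi> S) = S"
    for P Q and H :: "'a set \<times> 'x \<Rightarrow> 'a set \<times> 'x \<Rightarrow> ('a \<Rightarrow> 'a) set"
      and K :: "'a set \<times> 'y \<Rightarrow> 'a set \<times> 'y \<Rightarrow> ('a \<Rightarrow> 'a) set" and \<phi> \<psi>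
    using that
    by (auto simp: comp_functor_def id_functor_def restructure_def concrete_category_def
        compose_def fun_eq_iff restrict_def)
  show ?thesis
    unfolding inverse_functors_def
    by (intro conjI is_functor_restructure inv assms)
qed

section \<open>The isomorphism of categories\<close>

lemma structured_sets_diffeological: "structured_sets diffeological_space dsmooth"
  unfolding structured_sets_def
proof (intro conjI allI impI)
  show "dsmooth S T \<subseteq> fst S \<rightarrow>\<^sub>E fst T" for S T :: "'a dspace"
    by (auto simp: dsmooth_def)
  show "(\<lambda>x\<in>fst S. x) \<in> dsmooth S S" if S: "diffeological_space S" for S :: "'a dspace"
  proof -
    have "compose U (\<lambda>x\<in>fst S. x) p = p" if "(n, U, p) \<in> snd S" for n U p
    proof -
      have "p \<in> U \<rightarrow>\<^sub>E fst S"
        using S that by (auto simp: diffeological_space_def is_diffeology_def params_def)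
      then show ?thesis by (fastforce simp: compose_def fun_eq_iff)
    qed
    then show ?thesis by (auto simp: dsmooth_def)
  qed
  show "compose (fst R) G F \<in> dsmooth R T"
    if *: "diffeological_space R \<and> diffeological_space S \<and> diffeological_space T \<and>
      F \<in> dsmooth R S \<and> G \<in> dsmooth S T" for R S T :: "'a dspace" and F G
  proof -
    have "(n, U, compose U (compose (fst R) G F) p) \<in> snd T" if p: "(n, U, p) \<in> snd R" for n U p
    proof -
      have "p \<in> U \<rightarrow> fst R"
        using * p by (auto simp: diffeological_space_def is_diffeology_def params_def)
      then have "compose U (compose (fst R) G F) p = compose U G (compose U F p)"
        by (auto simp: compose_def fun_eq_iff)
      moreover have "(n, U, compose U F p) \<in> snd S"
        using * p by (auto simp: dsmooth_def)
      then have "(n, U, compose U G (compose U F p)) \<in> snd T"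
        using * by (auto simp: dsmooth_def)
      ultimately show ?thesis by simp
    qed
    moreover have "compose (fst R) G F \<in> fst R \<rightarrow>\<^sub>E fst T"
      using * by (auto simp: dsmooth_def compose_def)
    ultimately show ?thesis by (auto simp: dsmooth_def)
  qed
qed

lemma structured_sets_differential: "structured_sets differential_space fsmooth"
  unfolding structured_sets_def
proof (intro conjI allI impI)
  show "fsmooth S T \<subseteq> fst S \<rightarrow>\<^sub>E fst T" for S T :: "'a fspace"
    by (auto simp: fsmooth_def)
  show "(\<lambda>x\<in>fst S. x) \<in> fsmooth S S" if S: "differential_space S" for S :: "'a fspace"
  proof -
    have "compose (fst S) f (\<lambda>x\<in>fst S. x) = f" if "f \<in> snd S" for f
    proof -
      have "f \<in> real_funs (fst S)"
        using S that by (auto simp: differential_space_def is_differential_structure_def)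
      then show ?thesis by (auto simp: real_funs_def compose_def fun_eq_iff)
    qed
    then show ?thesis by (auto simp: fsmooth_def)
  qed
  show "compose (fst R) G F \<in> fsmooth R T"
    if *: "differential_space R \<and> differential_space S \<and> differential_space T \<and>
      F \<in> fsmooth R S \<and> G \<in> fsmooth S T" for R S T :: "'a fspace" and F G
  proof -
    have "compose (fst R) f (compose (fst R) G F) \<in> snd R" if f: "f \<in> snd T" for f
    proof -
      have "F \<in> fst R \<rightarrow> fst S" using * by (auto simp: fsmooth_def)
      then have "compose (fst R) f (compose (fst R) G F) = compose (fst R) (compose (fst S) f G) F"
        by (auto simp: compose_def fun_eq_iff)
      moreover have "compose (fst S) f G \<in> snd S" using * f by (auto simp: fsmooth_def)
      then have "compose (fst R) (compose (fst S) f G) F \<in> snd R"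
        using * by (auto simp: fsmooth_def)
      ultimately show ?thesis by simp
    qed
    moreover have "compose (fst R) G F \<in> fst R \<rightarrow>\<^sub>E fst T"
      using * by (auto simp: fsmooth_def compose_def)
    ultimately show ?thesis by (auto simp: fsmooth_def)
  qed
qed

definition Phi_space :: "'a dspace \<Rightarrow> 'a fspace"
  where "Phi_space S = (fst S, Phi (fst S) (snd S))"

definition Pai_space :: "'a fspace \<Rightarrow> 'a dspace"
  where "Pai_space S = (fst S, Pai (fst S) (snd S))"

lemma fst_Phi_space [simp]: "fst (Phi_space S) = fst S"
  by (simp add: Phi_space_def)

lemma fst_Pai_space [simp]: "fst (Pai_space S) = fst S"
  by (simp add: Pai_space_def)

lemma Phi_functor_eq_restructure:
  "Phi_functor = restructure diffeological_space dsmooth Phi_space"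
  by (auto simp: Phi_functor_def restructure_def Diffeol_def Phi_space_def fun_eq_iff restrict_def)

lemma Pai_functor_eq_restructure:
  "Pai_functor = restructure differential_space fsmooth Pai_space"
  by (auto simp: Pai_functor_def restructure_def DiffSp_def Pai_space_def fun_eq_iff restrict_def)

text \<open>\<open>\<Phi>\<close> lands in reflexive spaces, even from a space that is not reflexive, by \<open>\<Phi>\<Pi>\<Phi> = \<Phi>\<close>.\<close>

lemma Phi_space_reflexive:
  assumes "diffeological_space S"
  shows "differential_space (Phi_space S) \<and> reflexive_fspace (Phi_space S)"
proof -
  have "snd S \<subseteq> params (fst S)"
    using assms by (auto simp: diffeological_space_def is_diffeology_def)
  then show ?thesis
    using assms is_differential_structure_Phi[of "snd S" "fst S"] Phi_Pai_Phi[of "snd S" "fst S"]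
    by (simp add: Phi_space_def differential_space_def reflexive_fspace_def diffeological_space_def)
qed

lemma Pai_space_reflexive:
  assumes "differential_space S"
  shows "diffeological_space (Pai_space S) \<and> reflexive_dspace (Pai_space S)"
proof -
  have "snd S \<subseteq> real_funs (fst S)"
    using assms by (auto simp: differential_space_def is_differential_structure_def)
  then show ?thesis
    using assms is_diffeology_Pai[of "fst S" "snd S"] Pai_Phi_Pai[of "snd S" "fst S"]
    by (simp add: Pai_space_def differential_space_def reflexive_dspace_def diffeological_space_def)
qed

lemma dsmooth_imp_fsmooth_Phi_space:
  assumes "diffeological_space S" "F \<in> dsmooth S T"
  shows "F \<in> fsmooth (Phi_space S) (Phi_space T)"
  using assms dsmooth_imp_fsmooth_Phi[of "snd S" "fst S" F "fst T" "snd T"]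
  by (auto simp: Phi_space_def diffeological_space_def is_diffeology_def)

lemma fsmooth_imp_dsmooth_Pai_space:
  assumes "F \<in> fsmooth S T"
  shows "F \<in> dsmooth (Pai_space S) (Pai_space T)"
  using assms fsmooth_imp_dsmooth_Pai[of F "fst S" "snd S" "fst T" "snd T"]
  by (simp add: Pai_space_def)

lemma Pai_space_Phi_space: "reflexive_dspace S \<Longrightarrow> Pai_space (Phi_space S) = S"
  by (simp add: Pai_space_def Phi_space_def reflexive_dspace_def)

lemma Phi_space_Pai_space: "reflexive_fspace S \<Longrightarrow> Phi_space (Pai_space S) = S"
  by (simp add: Pai_space_def Phi_space_def reflexive_fspace_def)

theorem theorem2p11:
  shows "is_functor (Diffeol :: ('a, 'a param set) space_cat) ReflDiffSp Phi_functor \<and>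
    is_functor (DiffSp :: ('a, ('a \<Rightarrow> real) set) space_cat) ReflDiffeol Pai_functor \<and>
    is_isomorphism (ReflDiffeol :: ('a, 'a param set) space_cat) ReflDiffSp
      (restrict_functor Phi_functor ReflDiffeol) \<and>
    is_isomorphism (ReflDiffSp :: ('a, ('a \<Rightarrow> real) set) space_cat) ReflDiffeol
      (restrict_functor Pai_functor ReflDiffSp) \<and>
    inverse_functors (ReflDiffeol :: ('a, 'a param set) space_cat) ReflDiffSp
      (restrict_functor Phi_functor ReflDiffeol) (restrict_functor Pai_functor ReflDiffSp)"
proof -
  note structured = structured_sets_diffeological structured_sets_differential
  note refl_structured = structured[THEN structured_sets_subclass]
  note spaces = Phi_space_reflexive Pai_space_reflexive
    dsmooth_imp_fsmooth_Phi_space fsmooth_imp_dsmooth_Pai_space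
    Pai_space_Phi_space Phi_space_Pai_space
  note unfolds = Diffeol_def DiffSp_def ReflDiffeol_def ReflDiffSp_def
    full_subcategory_concrete_category Phi_functor_eq_restructure Pai_functor_eq_restructure
    restrict_functor_restructure
  have Phi: "is_functor (Diffeol :: ('a, 'a param set) space_cat) ReflDiffSp Phi_functor"
    unfolding unfolds
    by (rule is_functor_restructure[OF structured(1) refl_structured(2)]) (auto simp: spaces)
  have Pai: "is_functor (DiffSp :: ('a, ('a \<Rightarrow> real) set) space_cat) ReflDiffeol Pai_functor"
    unfolding unfolds
    by (rule is_functor_restructure[OF structured(2) refl_structured(1)]) (auto simp: spaces)
  have inv: "inverse_functors (ReflDiffeol :: ('a, 'a param set) space_cat) ReflDiffSp
      (restrict_functor Phi_functor ReflDiffeol) (restrict_functor Pai_functor ReflDiffSp)"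
    unfolding unfolds
    by (rule inverse_functors_restructure[OF refl_structured]) (auto simp: spaces)
  then have "inverse_functors (ReflDiffSp :: ('a, ('a \<Rightarrow> real) set) space_cat) ReflDiffeol
      (restrict_functor Pai_functor ReflDiffSp) (restrict_functor Phi_functor ReflDiffeol)"
    by (simp add: inverse_functors_def)
  then show ?thesis
    using Phi Pai inv unfolding is_isomorphism_def by blast
qed

end
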